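(* For every positive integer $\mu$ there exists a chordal graph $G$ such that no set of at most $\mu$ spanning trees of $G$ collectively $+2$-spans $G$.
   Context: All graphs are connected, finite, undirected, loopless and without multiple edges; $\mathrm{dist}_G(u,v)$ is the number of edges of a shortest path between $u$ and $v$ in $G$. For $c\ge 0$, a set $\mathcal{T}$ of spanning trees of a graph $G$ collectively $+c$-spans $G$ if for any two vertices $u,v$ of $G$ there is a tree $T\in\mathcal{T}$ with $\mathrm{dist}_T(u,v)\le \mathrm{dist}_G(u,v)+c$. A graph is chordal if it does not contain any induced cycle of length greater than 3. *)

theory Defs
  imports "Graph_Theory.Graph_Theory"
begin

text \<open>
  An undirected simple graph is a finite, loop-free, symmetric set of pairs: the edge between
  \<open>u\<close> and \<open>v\<close> is represented by the two arcs \<open>(u, v)\<close> and \<open>(v, u)\<close>.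
  Connectedness includes non-emptiness of the vertex set.
\<close>

definition connected_graph :: "'a pair_pre_digraph \<Rightarrow> bool" where
  "connected_graph G \<longleftrightarrow> pair_graph G \<and> connected G"

text \<open>
  In a symmetric digraph every edge yields the directed cycle \<open>u, v, u\<close>; an undirected cycle
  is a directed one with at least three vertices.
\<close>

definition undirected_cycle :: "'a pair_pre_digraph \<Rightarrow> ('a \<times> 'a) awalk \<Rightarrow> bool" where
  "undirected_cycle G p \<longleftrightarrow> pre_digraph.cycle G p \<and> 3 \<le> length p"

text \<open>
  The vertices of a cycle \<open>p\<close> are \<open>fst ` set p\<close>. It is induced if the edges of \<open>G\<close> between
  them, each taken in both directions, are those of \<open>p\<close>.
\<close>

definition induced_cycle :: "'a pair_pre_digraph \<Rightarrow> ('a \<times> 'a) awalk \<Rightarrow> bool" where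
  "induced_cycle G p \<longleftrightarrow>
     undirected_cycle G p \<and> arcs (G \<restriction> (fst ` set p)) = set p \<union> (set p)\<inverse>"

definition chordal :: "'a pair_pre_digraph \<Rightarrow> bool" where
  "chordal G \<longleftrightarrow> \<not> (\<exists>p. induced_cycle G p \<and> 3 < length p)"

text \<open>
  The library predicate \<open>spanning_tree\<close> forbids directed cycles, hence no symmetric digraph
  with an edge satisfies it, whereas an orientation of a triangle may. The following is the
  undirected notion.
\<close>

definition undirected_spanning_tree :: "'a pair_pre_digraph \<Rightarrow> 'a pair_pre_digraph \<Rightarrow> bool" where
  "undirected_spanning_tree T G \<longleftrightarrow>
     connected_graph T \<and> \<not> (\<exists>p. undirected_cycle T p) \<and> spanning T G"

text \<open>
  The library's \<open>\<mu>\<close> is the infimum of the weights of the walks from \<open>u\<close> to \<open>v\<close>; with unit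
  weights in a connected graph this is the number of edges of a shortest path.
\<close>

definition graph_dist :: "'a pair_pre_digraph \<Rightarrow> 'a \<Rightarrow> 'a \<Rightarrow> ereal" where
  "graph_dist G u v = wf_digraph.\<mu> G (\<lambda>_. 1) u v"

definition collectively_spans ::
    "'a pair_pre_digraph set \<Rightarrow> real \<Rightarrow> 'a pair_pre_digraph \<Rightarrow> bool" where
  "collectively_spans \<T> c G \<longleftrightarrow>
     (\<forall>u \<in> pverts G. \<forall>v \<in> pverts G. \<exists>T \<in> \<T>. graph_dist T u v \<le> graph_dist G u v + ereal c)"

end

theory Submission
  imports Defs
begin

text \<open>
  Take a large finite piece of a universal chordal graph in which every clique \<open>S\<close> is the set of
  smaller neighbours of many vertices \<open>w\<close>, the copies of \<open>S\<close>. The descendants of different copies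
  are disjoint and separated from the rest by \<open>S\<close>. A rooted spanning tree can have parents of
  elements of \<open>S\<close> below at most \<open>card S\<close> copies, so below some copy each of the \<open>\<mu>\<close> trees connects
  no two elements of \<open>S\<close>. For \<open>x\<close> below such a copy, every tree path from \<open>x\<close> into \<open>S\<close> then
  enters \<open>S\<close> at one vertex \<open>r\<close> depending only on \<open>x\<close> and the tree, so that
  \<open>dist x y \<ge> 1 + dist r y\<close> for all \<open>y \<in> S\<close>.

  This yields cliques \<open>K 0, \<dots>, K \<mu>\<close>, with complete union, such that in each tree distinct vertices
  are at distance at least 2, and at least 3 if they lie in different cliques. To add a clique,
  attach a large one below a good copy of the union, keep its vertices of one depth parity with
  respect to every tree, and delete the entry vertices of these from the older cliques. Finally
  attach one more vertex \<open>x\<close>. Its at most \<open>\<mu>\<close> entry vertices miss one of the \<open>\<mu> + 1\<close> cliques, and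
  a neighbour of \<open>x\<close> in that clique is at distance at least 4 from \<open>x\<close> in every tree.
\<close>

section \<open>A universal chordal graph\<close>

lemma in_set_decode_less: "b < x" if "b \<in> set_decode x"
proof -
  have "x div 2 ^ b \<noteq> 0"
    using that by (auto simp: set_decode_def elim: oddE)
  then have "2 ^ b \<le> x"
    by (simp add: div_eq_0_iff)
  then show ?thesis
    using less_exp[of b] by linarith
qed

lemma in_set_decode_fst_less: "b < v" if "b \<in> set_decode (fst (prod_decode v))"
  using in_set_decode_less[OF that] le_prod_encode_1[of "fst (prod_decode v)" "snd (prod_decode v)"]
  by simp

text \<open>
  \<open>lower v\<close> is the set of smaller neighbours of \<open>v\<close>. The vertex \<open>v\<close> codes a finite set and an index;
  if the set is not a nonempty clique, \<open>v\<close> is joined to \<open>0\<close> only, which keeps the graph connected.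
\<close>
function lower :: "nat \<Rightarrow> nat set" where
  "lower v = (let S = set_decode (fst (prod_decode v)) in
     if S \<noteq> {} \<and> (\<forall>b\<in>S. \<forall>a\<in>S. a < b \<longrightarrow> a \<in> lower b) then S else {0} \<inter> {..<v})"
  by auto
termination
  by (relation "measure id") (auto dest: in_set_decode_fst_less)

declare lower.simps [simp del]

definition clique :: "nat set \<Rightarrow> bool" where
  "clique S \<longleftrightarrow> (\<forall>b\<in>S. \<forall>a\<in>S. a < b \<longrightarrow> a \<in> lower b)"

definition adj :: "nat rel" where
  "adj = {(u, v). u \<in> lower v \<or> v \<in> lower u}"

text \<open>For a finite nonempty clique \<open>S\<close>, varying \<open>j\<close> yields
  infinitely many vertices whose set of smaller neighbours is exactly \<open>S\<close>.\<close>

definition copy :: "nat set \<Rightarrow> nat \<Rightarrow> nat" where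
  "copy S j = prod_encode (set_encode S, j)"

lemma lower_less: "u \<in> lower v \<Longrightarrow> u < v"
  by (subst (asm) lower.simps) (auto simp: Let_def in_set_decode_fst_less split: if_splits)

lemma clique_lower: "clique (lower v)"
  unfolding clique_def by (subst (1 2) lower.simps) (auto simp: Let_def)

lemma clique_adj: "clique S \<Longrightarrow> u \<in> S \<Longrightarrow> v \<in> S \<Longrightarrow> u \<noteq> v \<Longrightarrow> (u, v) \<in> adj"
  unfolding clique_def adj_def by (auto simp: neq_iff)

lemma clique_subset: "clique S \<Longrightarrow> A \<subseteq> S \<Longrightarrow> clique A"
  unfolding clique_def by blast

lemma ex_in_lower: "\<exists>u. u \<in> lower v" if "0 < v"
  using that by (subst lower.simps) (auto simp: Let_def)

lemma less_copy:
  assumes "finite S" "b \<in> S"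
  shows "b < copy S j"
proof -
  have "b < set_encode S"
    using assms by (intro in_set_decode_less) simp
  also have "\<dots> \<le> copy S j"
    unfolding copy_def by (rule le_prod_encode_1)
  finally show ?thesis .
qed

lemma lower_copy:
  assumes "finite S" "S \<noteq> {}" "clique S"
  shows "lower (copy S j) = S"
proof -
  have "set_decode (fst (prod_decode (copy S j))) = S"
    using assms(1) by (simp add: copy_def)
  then show ?thesis
    using assms less_copy[OF assms(1)] by (subst lower.simps) (auto simp: Let_def clique_def)
qed

lemma copy_eq_iff: "copy S i = copy S j \<longleftrightarrow> i = j"
  by (simp add: copy_def)

lemma clique_insert_copy:
  assumes "finite S" "S \<noteq> {}" "clique S"
  shows "clique (insert (copy S j) S)"
  using assms less_copy[OF assms(1)] lower_copy[OF assms]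
  unfolding clique_def by (metis insert_iff less_asym' order_less_irrefl)

section \<open>Descendants of a vertex and cliques among them\<close>

inductive_set descendants :: "nat \<Rightarrow> nat set" for w where
  self: "w \<in> descendants w"
| step: "x \<in> descendants w \<Longrightarrow> x \<in> lower v \<Longrightarrow> v \<in> descendants w"

lemma descendants_ge: "v \<in> descendants w \<Longrightarrow> w \<le> v"
  by (induction rule: descendants.induct) (auto dest: lower_less)

text \<open>A neighbour of \<open>x\<close> outside the descendants must be smaller than
  \<open>x\<close>, or it would be a descendant itself. It then lies in the clique
  \<open>lower x\<close> together with the descendant from which \<open>x\<close> arose, so it is
  adjacent to that one too; repeat down to \<open>w\<close>.\<close>

lemma adj_descendants_boundary:
  assumes "x \<in> descendants w" "u \<notin> descendants w" "(x, u) \<in> adj"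
  shows "u \<in> lower w"
proof -
  have "u \<in> lower x"
    using assms descendants.step unfolding adj_def by blast
  with assms(1) show ?thesis
  proof (induction rule: descendants.induct)
    case (step x v)
    have "(x, u) \<in> adj"
      using clique_adj[OF clique_lower] step.hyps step.prems assms(2) by blast
    with step assms(2) show ?case
      using descendants.step unfolding adj_def by blast
  qed
qed

text \<open>A common descendant \<open>v\<close> other than \<open>w\<close> and \<open>w'\<close>
  has smaller neighbours in both sets. As \<open>lower v\<close> is a clique, these are equal or
  adjacent, so one of them is a smaller common descendant. If \<open>v\<close> is \<open>w\<close>,
  some element of \<open>lower w = lower w'\<close> would be a descendant of \<open>w'\<close>
  smaller than \<open>w'\<close>; symmetrically for \<open>w'\<close>.\<close>

lemma descendants_disjoint:
  assumes "lower w = lower w'" "w \<noteq> w'"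
  shows "descendants w \<inter> descendants w' = {}"
proof -
  have False if "v \<in> descendants w" "v \<in> descendants w'" for v
    using that
  proof (induction v rule: less_induct)
    case (less v)
    have no_common: False if "x \<in> descendants w" "x \<in> lower v" "y \<in> descendants w'" "y \<in> lower v" for x y
    proof -
      have "x < v" "y < v"
        using that lower_less by auto
      moreover have "x = y \<or> x \<in> lower y \<or> y \<in> lower x"
        using clique_adj[OF clique_lower that(2,4)] by (auto simp: adj_def)
      ultimately show False
        using less.IH that descendants.step by metis
    qed
    have meets: "v \<noteq> w \<Longrightarrow> \<exists>x\<in>descendants w. x \<in> lower v" "v \<noteq> w' \<Longrightarrow> \<exists>y\<in>descendants w'. y \<in> lower v"
      using less.prems by (auto elim: descendants.cases)
    show False
    proof (cases "v = w \<or> v = w'")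
      case True
      then show False
        using meets assms lower_less descendants_ge by (metis leD)
    next
      case False
      then show False
        using meets no_common by blast
    qed
  qed
  then show ?thesis by blast
qed

text \<open>Vertices are added one at a time, each a copy of the whole clique built so far, hence
  adjacent to an earlier descendant.\<close>

lemma ex_clique_of_descendants:
  assumes "finite S" "S \<noteq> {}" "clique S"
  shows "\<exists>W. finite W \<and> card W = N \<and> W \<subseteq> descendants (copy S j) \<and> clique (S \<union> W)"
proof (induction N)
  case 0
  show ?case
    using assms by (intro exI[of _ "{}"]) simp
next
  case (Suc N)
  then obtain W where W: "finite W" "card W = N" "W \<subseteq> descendants (copy S j)" "clique (S \<union> W)"
    by blast
  define T where "T = S \<union> W"
  have T: "finite T" "T \<noteq> {}" "clique T"
    using assms W by (auto simp: T_def)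
  \<comment> \<open>For \<open>W = {}\<close> the vertex \<open>copy T 0\<close> would be
    \<open>copy S 0\<close>, which is not a descendant of \<open>copy S j\<close> when
    \<open>j\<close> is not 0.\<close>
  define v where "v = (if W = {} then copy S j else copy T 0)"
  have "clique (insert v (S \<union> W))"
    using clique_insert_copy[OF assms] clique_insert_copy[OF T] by (auto simp: v_def T_def)
  moreover have "v \<in> descendants (copy S j)"
  proof (cases "W = {}")
    case False
    then obtain x where "x \<in> W" by blast
    then show ?thesis
      using False W(3) descendants.step[of x "copy S j" "copy T 0"] lower_copy[OF T]
      by (auto simp: v_def T_def)
  qed (simp add: v_def descendants.self)
  moreover have "v \<notin> W"
    using less_copy[OF T(1), of v 0] by (cases "W = {}") (auto simp: v_def T_def)
  ultimately show ?case
    using W by (intro exI[of _ "insert v W"]) auto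
qed

section \<open>Distances in spanning trees\<close>

text \<open>The decrease of \<open>dep\<close> makes iterated parents reach the root
  \<open>0\<close>. The value \<open>par 0\<close> is unconstrained, which explains the guards
  \<open>0 < u\<close> and \<open>0 < v\<close>.\<close>

definition rooted_tree :: "nat \<Rightarrow> nat rel \<Rightarrow> (nat \<Rightarrow> nat) \<Rightarrow> (nat \<Rightarrow> nat) \<Rightarrow> bool" where
  "rooted_tree n R par dep \<longleftrightarrow> R \<subseteq> adj \<inter> {..<n} \<times> {..<n} \<and> sym R \<and>
     (\<forall>x. 0 < x \<and> x < n \<longrightarrow> (x, par x) \<in> R \<and> dep x = Suc (dep (par x))) \<and>
     (\<forall>(u, v) \<in> R. 0 < u \<and> v = par u \<or> 0 < v \<and> u = par v)"

text \<open>Bounding the lengths of all walks replaces a distance function and makes sense for any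
  relation, connected or not.\<close>

definition far :: "'a rel \<Rightarrow> nat \<Rightarrow> 'a \<Rightarrow> 'a \<Rightarrow> bool" where
  "far R k x y \<longleftrightarrow> (\<forall>l<k. (x, y) \<notin> R ^^ l)"

lemma far_mono: "far R l x y \<Longrightarrow> k \<le> l \<Longrightarrow> far R k x y"
  by (simp add: far_def)

lemma sym_relpow: "sym R \<Longrightarrow> sym (R ^^ l)"
proof (induction l)
  case (Suc l)
  show ?case
  proof (rule symI)
    fix x y assume "(x, y) \<in> R ^^ Suc l"
    then obtain z where "(x, z) \<in> R ^^ l" "(z, y) \<in> R"
      by (rule relpow_Suc_E)
    then show "(y, x) \<in> R ^^ Suc l"
      using Suc by (meson relpow_Suc_I2 symD)
  qed
qed (simp add: sym_def)

lemma far_sym: "sym R \<Longrightarrow> far R k x y \<Longrightarrow> far R k y x"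
  unfolding far_def using sym_relpow[of R] by (meson symD)

lemma far_2_iff: "far R 2 x y \<longleftrightarrow> x \<noteq> y \<and> (x, y) \<notin> R"
  by (auto simp: far_def numeral_2_eq_2 less_Suc_eq)

text \<open>A relation rather than a recursive function, because following an arbitrary
  \<open>par\<close> need not ever leave \<open>D\<close>.\<close>

inductive exit_vertex :: "(nat \<Rightarrow> nat) \<Rightarrow> nat set \<Rightarrow> nat \<Rightarrow> nat \<Rightarrow> bool" for par D where
  out: "par x \<notin> D \<Longrightarrow> exit_vertex par D x (par x)"
| up: "par x \<in> D \<Longrightarrow> exit_vertex par D (par x) r \<Longrightarrow> exit_vertex par D x r"

text \<open>Tree edges inside the descendants join a vertex to its parent, so they preserve the exit
  vertex. The walk can leave only into \<open>lower w\<close>; by \<open>good\<close> the edge used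
  goes from child to parent, so it ends at the exit vertex \<open>r\<close>, and the rest of the
  walk is shorter.\<close>

lemma exit_vertex_walk:
  assumes tree: "rooted_tree n R par dep"
    and good: "\<And>s. s \<in> lower w \<Longrightarrow> par s \<notin> descendants w"
    and "exit_vertex par (descendants w) x r" "x \<in> descendants w" "k \<in> lower w" "(x, k) \<in> R ^^ l"
  shows "\<exists>l'<l. (r, k) \<in> R ^^ l'"
  using assms(3,4,6)
proof (induction l arbitrary: x)
  case 0
  then show ?case
    using assms(5) descendants_ge lower_less by fastforce
next
  case (Suc l)
  then obtain y where y: "(x, y) \<in> R" "(y, k) \<in> R ^^ l"
    by (metis relpow_Suc_D2)
  have "(x, y) \<in> adj" "y = par x \<or> x = par y"
    using tree y(1) unfolding rooted_tree_def by blast+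
  show ?case
  proof (cases "y \<in> descendants w")
    case True
    have "exit_vertex par (descendants w) y r"
      using \<open>y = par x \<or> x = par y\<close>
    proof
      assume "y = par x"
      then show ?thesis
        using Suc.prems(1) True by (auto elim: exit_vertex.cases)
    next
      assume "x = par y"
      then show ?thesis
        using Suc.prems exit_vertex.up by blast
    qed
    then show ?thesis
      using Suc.IH True y(2) less_SucI by blast
  next
    case False
    then have "y \<in> lower w"
      using adj_descendants_boundary Suc.prems(2) \<open>(x, y) \<in> adj\<close> by blast
    then have "y = par x"
      using good Suc.prems(2) \<open>y = par x \<or> x = par y\<close> by blast
    then have "r = y"
      using Suc.prems(1) False by (auto elim: exit_vertex.cases)
    then show ?thesis
      using y(2) by blast
  qed
qed

text \<open>Climbing ends because depth decreases and the root \<open>0\<close> is not a descendant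
  of a positive \<open>w\<close>; the first vertex outside lies in \<open>lower w\<close> by the
  boundary property.\<close>

lemma ex_exit_vertex:
  assumes tree: "rooted_tree n R par dep" and "0 < w" "x \<in> descendants w" "x < n"
  shows "\<exists>r\<in>lower w. exit_vertex par (descendants w) x r"
  using assms(3,4)
proof (induction "dep x" arbitrary: x rule: less_induct)
  case less
  have "0 < x"
    using less.prems(1) descendants_ge \<open>0 < w\<close> by fastforce
  then have "(x, par x) \<in> R" and dep: "dep (par x) < dep x"
    using tree less.prems unfolding rooted_tree_def by auto
  then have par: "(x, par x) \<in> adj" "par x < n"
    using tree unfolding rooted_tree_def by auto
  show ?case
  proof (cases "par x \<in> descendants w")
    case True
    then show ?thesis
      using less.hyps[OF dep True] True par exit_vertex.up by blast
  next
    case False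
    then show ?thesis
      using adj_descendants_boundary less.prems par exit_vertex.out by blast
  qed
qed


text \<open>The order of quantifiers matters: one \<open>r\<close> serves all targets
  \<open>k\<close> and all distances \<open>m\<close>.\<close>

lemma ex_roots:
  assumes tree: "rooted_tree n R par dep" and "0 < w"
    and good: "\<And>s. s \<in> lower w \<Longrightarrow> par s \<notin> descendants w"
    and "x \<in> descendants w" "x < n"
  shows "\<exists>r\<in>lower w. \<forall>k\<in>lower w. \<forall>m. far R m r k \<longrightarrow> far R (Suc m) x k"
proof -
  obtain r where r: "r \<in> lower w" "exit_vertex par (descendants w) x r"
    using ex_exit_vertex[OF tree assms(2,4,5)] by blast
  have "far R (Suc m) x k" if "k \<in> lower w" "far R m r k" for k m
    using that exit_vertex_walk[OF tree good r(2) assms(4) that(1)]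
    unfolding far_def by (metis less_SucE less_trans)
  then show ?thesis
    using r(1) by blast
qed

text \<open>Pigeonhole: a bad copy has a pair \<open>(i, s)\<close> whose parent lies below it.
  Descendants of different copies are disjoint, so different bad copies need different
  pairs.\<close>

lemma ex_good_copy:
  assumes S: "finite S" "S \<noteq> {}" "clique S" and "finite I" "card I * card S < J"
  shows "\<exists>j<J. \<forall>i\<in>I. \<forall>s\<in>S. par i s \<notin> descendants (copy S j)"
proof (rule ccontr)
  assume "\<not> ?thesis"
  then have "\<forall>j<J. \<exists>p\<in>I \<times> S. par (fst p) (snd p) \<in> descendants (copy S j)"
    by fastforce
  then obtain p where p: "\<And>j. j < J \<Longrightarrow> p j \<in> I \<times> S \<and> par (fst (p j)) (snd (p j)) \<in> descendants (copy S j)"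
    by metis
  have "inj_on p {..<J}"
  proof (rule inj_onI)
    fix i j assume "i \<in> {..<J}" "j \<in> {..<J}" "p i = p j"
    then have "descendants (copy S i) \<inter> descendants (copy S j) \<noteq> {}"
      using p[of i] p[of j] by auto
    then show "i = j"
      using descendants_disjoint[of "copy S i" "copy S j"] lower_copy[OF S] by (auto simp: copy_eq_iff)
  qed
  moreover have "p ` {..<J} \<subseteq> I \<times> S"
    using p by blast
  ultimately have "card {..<J} \<le> card (I \<times> S)"
    using assms by (intro card_inj_on_le) auto
  then show False
    using assms by (simp add: card_cartesian_product)
qed

section \<open>Extending a clique, uniformly for all small families of trees\<close>

definition is_tree :: "nat \<Rightarrow> nat rel \<Rightarrow> bool" where
  "is_tree n R \<longleftrightarrow> (\<exists>par dep. rooted_tree n R par dep)"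

definition tree_family :: "nat \<Rightarrow> nat \<Rightarrow> nat rel set \<Rightarrow> bool" where
  "tree_family k n \<R> \<longleftrightarrow> finite \<R> \<and> card \<R> \<le> k \<and> (\<forall>R\<in>\<R>. is_tree n R)"

text \<open>\<open>rt R x\<close> is the vertex where the paths in \<open>R\<close> from \<open>x\<close> enter \<open>S\<close>.\<close>
definition rooted_extension ::
    "nat rel set \<Rightarrow> nat set \<Rightarrow> nat set \<Rightarrow> (nat rel \<Rightarrow> nat \<Rightarrow> nat) \<Rightarrow> bool" where
  "rooted_extension \<R> S W rt \<longleftrightarrow> S \<inter> W = {} \<and> clique (S \<union> W) \<and>
     (\<forall>R\<in>\<R>. \<forall>x\<in>W. rt R x \<in> S \<and>
        (\<forall>y\<in>S. \<forall>m. far R m (rt R x) y \<longrightarrow> far R (Suc m) x y))"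

text \<open>The bound \<open>b'\<close> is fixed before the trees and \<open>n\<close>, so that a
  single finite graph can defeat all families. This is possible because there are only finitely many
  \<open>S\<close> below \<open>b\<close>, each with a bounded number of copies to try.\<close>

lemma obtain_rooted_extension:
  fixes b k N :: nat
  obtains b' where "b \<le> b'"
    "\<And>n S \<R>. b' \<le> n \<Longrightarrow> S \<subseteq> {..<b} \<Longrightarrow> S \<noteq> {} \<Longrightarrow> clique S \<Longrightarrow> tree_family k n \<R> \<Longrightarrow>
      \<exists>W rt. W \<subseteq> {..<b'} \<and> card W = N \<and> rooted_extension \<R> S W rt"
proof -
  define \<S> where "\<S> = {S. S \<subseteq> {..<b} \<and> S \<noteq> {} \<and> clique S}"
  have fin: "finite S" if "S \<in> \<S>" for S
    using that by (auto simp: \<S>_def intro: finite_subset)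
  have "\<forall>S\<in>\<S>. \<forall>j. \<exists>W. finite W \<and> card W = N \<and> W \<subseteq> descendants (copy S j) \<and> clique (S \<union> W)"
    using ex_clique_of_descendants fin by (auto simp: \<S>_def)
  then obtain W where W: "\<forall>S\<in>\<S>. \<forall>j. finite (W S j) \<and> card (W S j) = N \<and>
      W S j \<subseteq> descendants (copy S j) \<and> clique (S \<union> W S j)"
    by metis
  have W: "finite (W S j)" "card (W S j) = N" "W S j \<subseteq> descendants (copy S j)" "clique (S \<union> W S j)"
    if "S \<in> \<S>" for S j
    using W that by blast+
  have "finite \<S>"
    by (simp add: \<S>_def)
  \<comment> \<open>The \<open>k * b + 1\<close> copies are enough for \<open>ex_good_copy\<close>:
    at most \<open>k\<close> trees and at most \<open>b\<close> elements of
    \<open>S\<close>.\<close>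
  define U where "U = (\<Union>S\<in>\<S>. \<Union>j\<le>k * b. W S j)"
  have "finite U"
    unfolding U_def by (rule finite_UN_I[OF \<open>finite \<S>\<close>], rule finite_UN_I[OF finite_atMost], rule W(1))
  then obtain c where c: "\<And>u. u \<in> U \<Longrightarrow> u < c"
    unfolding finite_nat_set_iff_bounded by blast
  show ?thesis
  proof (rule that)
    fix n S \<R>
    assume n: "max b c \<le> n" and "S \<subseteq> {..<b}" "S \<noteq> {}" "clique S" "tree_family k n \<R>"
    then have S: "S \<in> \<S>" "S \<noteq> {}" "clique S" and "card S \<le> b"
      and \<R>: "finite \<R>" "card \<R> \<le> k" "\<And>R. R \<in> \<R> \<Longrightarrow> is_tree n R"
      using card_mono[of "{..<b}" S] by (auto simp: \<S>_def tree_family_def)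
    obtain par dep where tree: "\<And>R. R \<in> \<R> \<Longrightarrow> rooted_tree n R (par R) (dep R)"
      using \<R>(3) unfolding is_tree_def by metis
    have "card \<R> * card S < Suc (k * b)"
      using \<R>(2) \<open>card S \<le> b\<close> by (simp add: less_Suc_eq_le mult_le_mono)
    then obtain j where j: "j \<le> k * b" "\<forall>R\<in>\<R>. \<forall>s\<in>S. par R s \<notin> descendants (copy S j)"
      using ex_good_copy[OF fin[OF S(1)] S(2,3) \<R>(1), of _ par] by (metis less_Suc_eq_le)
    have low: "lower (copy S j) = S"
      using lower_copy fin S by blast
    then have "0 < copy S j"
      using S(2) lower_less by (metis ex_in_conv gr_zeroI not_less0)
    have disj: "S \<inter> W S j = {}"
      using W(3)[OF S(1), of j] descendants_ge less_copy[OF fin[OF S(1)]] by (fastforce dest: leD)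
    have bound: "W S j \<subseteq> {..<max b c}"
      using c j(1) S(1) by (fastforce simp: U_def)
    have "\<exists>r\<in>S. \<forall>y\<in>S. \<forall>m. far R m r y \<longrightarrow> far R (Suc m) x y" if "R \<in> \<R>" "x \<in> W S j" for R x
    proof -
      have "x \<in> descendants (copy S j)" "x < n"
        using W(3)[OF S(1), of j] bound n that by auto
      then show ?thesis
        using ex_roots[OF tree[OF that(1)] \<open>0 < copy S j\<close>, of x] j(2) that(1) low by auto
    qed
    then obtain rt where "\<forall>R\<in>\<R>. \<forall>x\<in>W S j. rt R x \<in> S \<and>
        (\<forall>y\<in>S. \<forall>m. far R m (rt R x) y \<longrightarrow> far R (Suc m) x y)"
      by metis
    then show "\<exists>W rt. W \<subseteq> {..<max b c} \<and> card W = N \<and> rooted_extension \<R> S W rt"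
      unfolding rooted_extension_def using bound W(2,4)[OF S(1), of j] disj by blast
  qed simp
qed

text \<open>The depths of adjacent vertices of a tree have different parity.\<close>
lemma ex_far_2_subset_aux:
  assumes "finite \<R>" "\<And>R. R \<in> \<R> \<Longrightarrow> is_tree n R" "2 ^ card \<R> * s \<le> card W"
  shows "\<exists>W'\<subseteq>W. card W' = s \<and> (\<forall>R\<in>\<R>. \<forall>x\<in>W'. \<forall>y\<in>W'. x \<noteq> y \<longrightarrow> far R 2 x y)"
  using assms
proof (induction \<R> arbitrary: s)
  case empty
  then show ?case
    using obtain_subset_with_card_n[of s W] by auto
next
  case (insert R \<R>)
  \<comment> \<open>The other trees leave \<open>2 * s\<close> vertices, so that one of the two
    parity classes for \<open>R\<close> still has \<open>s\<close>.\<close>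
  have "2 ^ card \<R> * (2 * s) \<le> card W"
    using insert by (simp add: mult_ac)
  then obtain W' where W': "W' \<subseteq> W" "card W' = 2 * s"
      "\<forall>R\<in>\<R>. \<forall>x\<in>W'. \<forall>y\<in>W'. x \<noteq> y \<longrightarrow> far R 2 x y"
    using insert.IH[of "2 * s"] insert.prems(1) by (meson insertCI)
  obtain par dep where tree: "rooted_tree n R par dep"
    using insert.prems unfolding is_tree_def by blast
  have edge: "even (dep x) \<noteq> even (dep y)" if "(x, y) \<in> R" for x y
  proof -
    have "x < n" "y < n" "0 < x \<and> y = par x \<or> 0 < y \<and> x = par y"
      using tree that unfolding rooted_tree_def by blast+
    then have "dep x = Suc (dep y) \<or> dep y = Suc (dep x)"
      using tree unfolding rooted_tree_def by blast
    then show ?thesis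
      by auto
  qed
  define P where "P b = {x \<in> W'. even (dep x) = b}" for b
  have "card W' = card (P True \<union> P False)"
    by (rule arg_cong[of _ _ card]) (auto simp: P_def)
  also have "\<dots> \<le> card (P True) + card (P False)"
    by (rule card_Un_le)
  finally have "s \<le> card (P True) \<or> s \<le> card (P False)"
    using W'(2) by linarith
  then obtain b where "s \<le> card (P b)"
    by blast
  then obtain W'' where W'': "W'' \<subseteq> P b" "card W'' = s"
    using obtain_subset_with_card_n by blast
  have "far R 2 x y" if "x \<in> W''" "y \<in> W''" "x \<noteq> y" for x y
  proof -
    have "even (dep x) = even (dep y)"
      using W''(1) that by (auto simp: P_def)
    then show ?thesis
      using edge that(3) by (auto simp: far_2_iff)
  qed
  moreover have "W'' \<subseteq> W'"
    using W''(1) by (auto simp: P_def)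
  ultimately have "\<forall>R'\<in>insert R \<R>. \<forall>x\<in>W''. \<forall>y\<in>W''. x \<noteq> y \<longrightarrow> far R' 2 x y"
    using W'(3) by blast
  then show ?case
    using W'(1) W''(2) \<open>W'' \<subseteq> W'\<close> by (intro exI[of _ W'']) blast
qed

lemma ex_far_2_subset:
  assumes "tree_family k n \<R>" "card W = 2 ^ k * s"
  shows "\<exists>W'\<subseteq>W. card W' = s \<and> (\<forall>R\<in>\<R>. \<forall>x\<in>W'. \<forall>y\<in>W'. x \<noteq> y \<longrightarrow> far R 2 x y)"
proof (rule ex_far_2_subset_aux)
  show "2 ^ card \<R> * s \<le> card W"
    using assms by (simp add: tree_family_def power_increasing)
qed (use assms in \<open>auto simp: tree_family_def\<close>)

section \<open>Families of cliques that are far apart in every tree\<close>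

definition far_family :: "nat rel set \<Rightarrow> nat \<Rightarrow> nat \<Rightarrow> (nat \<Rightarrow> nat set) \<Rightarrow> bool" where
  "far_family \<R> m s K \<longleftrightarrow> clique (\<Union>c\<le>m. K c) \<and> (\<forall>c\<le>m. s \<le> card (K c)) \<and>
     (\<forall>R\<in>\<R>. \<forall>c\<le>m. \<forall>x\<in>K c. \<forall>y\<in>K c. x \<noteq> y \<longrightarrow> far R 2 x y) \<and>
     (\<forall>R\<in>\<R>. \<forall>c\<le>m. \<forall>d\<le>m. \<forall>x\<in>K c. \<forall>y\<in>K d. c \<noteq> d \<longrightarrow> far R 3 x y)"

lemma far_familyD:
  assumes "far_family \<R> m s K"
  shows "clique (\<Union>c\<le>m. K c)" "c \<le> m \<Longrightarrow> s \<le> card (K c)"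
    "R \<in> \<R> \<Longrightarrow> c \<le> m \<Longrightarrow> d \<le> m \<Longrightarrow> x \<in> K c \<Longrightarrow> y \<in> K d \<Longrightarrow> c \<noteq> d \<Longrightarrow> far R 3 x y"
    "R \<in> \<R> \<Longrightarrow> c \<le> m \<Longrightarrow> d \<le> m \<Longrightarrow> x \<in> K c \<Longrightarrow> y \<in> K d \<Longrightarrow> x \<noteq> y \<Longrightarrow> far R 2 x y"
proof -
  show far3: "R \<in> \<R> \<Longrightarrow> c \<le> m \<Longrightarrow> d \<le> m \<Longrightarrow> x \<in> K c \<Longrightarrow> y \<in> K d \<Longrightarrow> c \<noteq> d \<Longrightarrow> far R 3 x y"
    using assms unfolding far_family_def by blast
  have far2: "R \<in> \<R> \<Longrightarrow> c \<le> m \<Longrightarrow> x \<in> K c \<Longrightarrow> y \<in> K c \<Longrightarrow> x \<noteq> y \<Longrightarrow> far R 2 x y"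
    using assms unfolding far_family_def by blast
  show "R \<in> \<R> \<Longrightarrow> c \<le> m \<Longrightarrow> d \<le> m \<Longrightarrow> x \<in> K c \<Longrightarrow> y \<in> K d \<Longrightarrow> x \<noteq> y \<Longrightarrow> far R 2 x y"
    using far2 far_mono[OF far3, of 2] by (cases "c = d") auto
qed (use assms in \<open>auto simp: far_family_def\<close>)

lemma tree_family_far_sym:
  "tree_family k n \<R> \<Longrightarrow> R \<in> \<R> \<Longrightarrow> far R l x y \<Longrightarrow> far R l y x"
  unfolding tree_family_def is_tree_def rooted_tree_def by (meson far_sym)

text \<open>The factor \<open>2 ^ k\<close> pays for one parity halving per tree. The surplus
  \<open>k * s\<close> in the old cliques pays for deleting the entry vertices, at most one for each
  tree and each of the \<open>s\<close> new vertices.\<close>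

lemma far_family_extend:
  assumes \<R>: "tree_family k n \<R>" and K: "far_family \<R> m (s + k * s) K"
    and ext: "rooted_extension \<R> (\<Union>c\<le>m. K c) W rt"
    and "card W = 2 ^ k * s" "0 < s"
  shows "\<exists>L. far_family \<R> (Suc m) s L \<and> (\<Union>c\<le>Suc m. L c) \<subseteq> (\<Union>c\<le>m. K c) \<union> W"
proof -
  define S where "S = (\<Union>c\<le>m. K c)"
  have rt: "rt R x \<in> S" "y \<in> S \<Longrightarrow> far R m (rt R x) y \<Longrightarrow> far R (Suc m) x y"
    if "R \<in> \<R>" "x \<in> W" for R x y m
    using ext that unfolding rooted_extension_def S_def by blast+
  obtain W' where W': "W' \<subseteq> W" "card W' = s"
      "\<forall>R\<in>\<R>. \<forall>x\<in>W'. \<forall>y\<in>W'. x \<noteq> y \<longrightarrow> far R 2 x y"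
    using ex_far_2_subset[OF \<R>, of W s] assms(4) by blast
  have "finite W'"
    using W'(2) \<open>0 < s\<close> by (simp add: card_ge_0_finite)
  define Q where "Q = (\<lambda>(R, x). rt R x) ` (\<R> \<times> W')"
  have "finite \<R>" "card \<R> \<le> k"
    using \<R> by (auto simp: tree_family_def)
  then have "finite Q"
    using \<open>finite W'\<close> by (simp add: Q_def)
  have "card Q \<le> card (\<R> \<times> W')"
    unfolding Q_def using \<open>finite \<R>\<close> \<open>finite W'\<close> by (intro card_image_le) simp
  also have "\<dots> \<le> k * s"
    using \<open>card \<R> \<le> k\<close> W'(2) by (simp add: card_cartesian_product)
  finally have "card Q \<le> k * s" .
  have large: "s \<le> card (K c - Q)" if "c \<le> m" for c
  proof -
    have "s + k * s - card Q \<le> card (K c) - card Q"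
      using far_familyD(2)[OF K that] by (rule diff_le_mono)
    also have "\<dots> \<le> card (K c - Q)"
      by (rule diff_card_le_card_Diff[OF \<open>finite Q\<close>])
    finally show ?thesis
      using \<open>card Q \<le> k * s\<close> by linarith
  qed
  have new: "far R 3 x y" if "R \<in> \<R>" "x \<in> W'" "c \<le> m" "y \<in> K c - Q" for R x c y
  proof -
    have "x \<in> W" "y \<in> S"
      using that W'(1) by (auto simp: S_def)
    have "rt R x \<in> S"
      using rt(1)[OF that(1) \<open>x \<in> W\<close>] .
    then obtain d where d: "d \<le> m" "rt R x \<in> K d"
      by (auto simp: S_def)
    have "rt R x \<in> Q"
      using that(1,2) by (auto simp: Q_def)
    then have "rt R x \<noteq> y"
      using that(4) by blast
    \<comment> \<open>Distance 2 holds for distinct vertices whether or not they lie in the same old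
      clique; the step into the entry vertex makes it 3.\<close>
    then have "far R 2 (rt R x) y"
      using far_familyD(4)[OF K that(1) d(1) that(3) d(2)] that(4) by blast
    then show ?thesis
      using rt(2)[OF that(1) \<open>x \<in> W\<close> \<open>y \<in> S\<close>, of 2] by (simp add: numeral_3_eq_3 numeral_2_eq_2)
  qed
  define L where "L c = (if c \<le> m then K c - Q else W')" for c
  have L: "(\<Union>c\<le>Suc m. L c) \<subseteq> S \<union> W"
    using W'(1) by (auto simp: L_def S_def)
  have "far_family \<R> (Suc m) s L"
    unfolding far_family_def
  proof (intro conjI ballI allI impI)
    have "clique (S \<union> W)"
      using ext by (simp add: rooted_extension_def S_def)
    then show "clique (\<Union>c\<le>Suc m. L c)"
      using L by (rule clique_subset)
  next
    show "s \<le> card (L c)" for c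
      using large W'(2) by (simp add: L_def)
  next
    fix R c x y assume "R \<in> \<R>" "x \<in> L c" "y \<in> L c" "x \<noteq> y"
    then show "far R 2 x y"
      using W'(3) far_familyD(4)[OF K] by (cases "c \<le> m") (auto simp: L_def)
  next
    fix R c d x y assume *: "R \<in> \<R>" "c \<le> Suc m" "d \<le> Suc m" "x \<in> L c" "y \<in> L d" "c \<noteq> d"
    consider "c \<le> m" "d \<le> m" | "c \<le> m" "\<not> d \<le> m" | "\<not> c \<le> m" "d \<le> m"
      using * by linarith
    then show "far R 3 x y"
    proof cases
      case 1
      then show ?thesis
        using far_familyD(3)[OF K *(1), of c d x y] * by (simp add: L_def)
    next
      case 2
      then show ?thesis
        using new[OF *(1), of y c x] tree_family_far_sym[OF \<R> *(1)] * by (simp add: L_def)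
    next
      case 3
      then show ?thesis
        using new[OF *(1), of x d y] * by (simp add: L_def)
    qed
  qed
  then show ?thesis
    using L unfolding S_def by blast
qed

text \<open>Induction with \<open>s\<close> arbitrary, since the smaller family has to consist of
  larger cliques.\<close>

lemma ex_far_family:
  fixes k m s :: nat
  assumes "0 < s"
  shows "\<exists>b. \<forall>n\<ge>b. \<forall>\<R>. tree_family k n \<R> \<longrightarrow>
    (\<exists>K. far_family \<R> m s K \<and> (\<Union>c\<le>m. K c) \<subseteq> {..<b})"
  using assms
proof (induction m arbitrary: s)
  case 0
  obtain b' where b': "\<And>n S \<R>. b' \<le> n \<Longrightarrow> S \<subseteq> {..<1} \<Longrightarrow> S \<noteq> {} \<Longrightarrow> clique S \<Longrightarrow>
      tree_family k n \<R> \<Longrightarrow>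
      \<exists>W rt. W \<subseteq> {..<b'} \<and> card W = 2 ^ k * s \<and> rooted_extension \<R> S W rt"
    by (rule obtain_rooted_extension[of 1 k "2 ^ k * s"]) blast
  show ?case
  proof (intro exI[of _ b'] allI impI)
    fix n \<R> assume n: "b' \<le> n" and \<R>: "tree_family k n \<R>"
    \<comment> \<open>The clique \<open>{0}\<close> only serves as the anchor of the first extension
      and is not kept in the family.\<close>
    have "clique {0}"
      by (simp add: clique_def)
    then obtain W rt where W: "W \<subseteq> {..<b'}" "card W = 2 ^ k * s" "rooted_extension \<R> {0} W rt"
      using b'[OF n _ _ _ \<R>, of "{0}"] by auto
    then obtain W' where W': "W' \<subseteq> W" "card W' = s" "\<forall>R\<in>\<R>. \<forall>x\<in>W'. \<forall>y\<in>W'. x \<noteq> y \<longrightarrow> far R 2 x y"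
      using ex_far_2_subset[OF \<R>] by blast
    moreover have "clique W'"
      using W(3) W'(1) unfolding rooted_extension_def by (blast intro: clique_subset)
    ultimately have "far_family \<R> 0 s (\<lambda>_. W')"
      by (simp add: far_family_def)
    then show "\<exists>K. far_family \<R> 0 s K \<and> (\<Union>c\<le>0. K c) \<subseteq> {..<b'}"
      using W(1) W'(1) by (intro exI[of _ "\<lambda>_. W'"]) auto
  qed
next
  case (Suc m)
  have "0 < s + k * s"
    using Suc.prems by simp
  then obtain b where b: "\<forall>n\<ge>b. \<forall>\<R>. tree_family k n \<R> \<longrightarrow>
      (\<exists>K. far_family \<R> m (s + k * s) K \<and> (\<Union>c\<le>m. K c) \<subseteq> {..<b})"
    using Suc.IH by metis
  obtain b' where "b \<le> b'" and b': "\<And>n S \<R>. b' \<le> n \<Longrightarrow> S \<subseteq> {..<b} \<Longrightarrow> S \<noteq> {} \<Longrightarrow> clique S \<Longrightarrow>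
      tree_family k n \<R> \<Longrightarrow>
      \<exists>W rt. W \<subseteq> {..<b'} \<and> card W = 2 ^ k * s \<and> rooted_extension \<R> S W rt"
    by (rule obtain_rooted_extension[of b k "2 ^ k * s"]) blast
  show ?case
  proof (intro exI[of _ b'] allI impI)
    fix n \<R> assume n: "b' \<le> n" and \<R>: "tree_family k n \<R>"
    obtain K where K: "far_family \<R> m (s + k * s) K" "(\<Union>c\<le>m. K c) \<subseteq> {..<b}"
      using b[rule_format, OF order_trans[OF \<open>b \<le> b'\<close> n] \<R>] by blast
    have "0 < card (K 0)"
      using far_familyD(2)[OF K(1), of 0] Suc.prems by linarith
    then have "(\<Union>c\<le>m. K c) \<noteq> {}"
      by fastforce
    then obtain W rt where W: "W \<subseteq> {..<b'}" "card W = 2 ^ k * s"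
        "rooted_extension \<R> (\<Union>c\<le>m. K c) W rt"
      using b'[OF n K(2) _ far_familyD(1)[OF K(1)] \<R>] by blast
    then obtain L where "far_family \<R> (Suc m) s L" "(\<Union>c\<le>Suc m. L c) \<subseteq> (\<Union>c\<le>m. K c) \<union> W"
      using far_family_extend[OF \<R> K(1)] Suc.prems by blast
    moreover have "(\<Union>c\<le>m. K c) \<union> W \<subseteq> {..<b'}"
      using W(1) K(2) \<open>b \<le> b'\<close> by (auto dest: subsetD)
    ultimately show "\<exists>K. far_family \<R> (Suc m) s K \<and> (\<Union>c\<le>Suc m. K c) \<subseteq> {..<b'}"
      by blast
  qed
qed

lemma obtain_far_edge:
  fixes k :: nat
  obtains n where "0 < n"
    "\<And>\<R>. tree_family k n \<R> \<Longrightarrow> \<exists>x<n. \<exists>y<n. (x, y) \<in> adj \<and> (\<forall>R\<in>\<R>. far R 4 x y)"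
proof -
  obtain b where b: "\<forall>n\<ge>b. \<forall>\<R>. tree_family k n \<R> \<longrightarrow>
      (\<exists>K. far_family \<R> k 1 K \<and> (\<Union>c\<le>k. K c) \<subseteq> {..<b})"
    \<comment> \<open>Index bound \<open>k\<close> gives \<open>k + 1\<close> cliques, one more than
      there are trees; size 1 just makes them nonempty.\<close>
    using ex_far_family[OF zero_less_one, of k k] by (elim exE)
  obtain b' where "b \<le> b'" and b': "\<And>n S \<R>. b' \<le> n \<Longrightarrow> S \<subseteq> {..<b} \<Longrightarrow> S \<noteq> {} \<Longrightarrow> clique S \<Longrightarrow>
      tree_family k n \<R> \<Longrightarrow>
      \<exists>W rt. W \<subseteq> {..<b'} \<and> card W = 1 \<and> rooted_extension \<R> S W rt"
    by (rule obtain_rooted_extension[of b k 1]) blast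
  show ?thesis
  proof (rule that)
    \<comment> \<open>Taking \<open>Suc b'\<close> for \<open>n\<close> makes \<open>n\<close>
      positive.\<close>
    fix \<R> assume \<R>: "tree_family k (Suc b') \<R>"
    obtain K where K: "far_family \<R> k 1 K" "(\<Union>c\<le>k. K c) \<subseteq> {..<b}"
      using b[rule_format, OF _ \<R>] \<open>b \<le> b'\<close> by auto
    define S where "S = (\<Union>c\<le>k. K c)"
    have nonempty: "K c \<noteq> {}" if "c \<le> k" for c
      using far_familyD(2)[OF K(1) that] by fastforce
    then have "S \<noteq> {}" "clique S"
      using far_familyD(1)[OF K(1)] by (auto simp: S_def)
    then obtain W rt where W: "W \<subseteq> {..<b'}" "card W = 1" and ext: "rooted_extension \<R> S W rt"
      using b'[of "Suc b'" S \<R>] K(2) \<R> unfolding S_def by auto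
    obtain x where x: "x \<in> W"
      using W(2) by (auto simp: card_1_singleton_iff)
    have rt: "rt R x \<in> S" "y \<in> S \<Longrightarrow> far R m (rt R x) y \<Longrightarrow> far R (Suc m) x y"
      if "R \<in> \<R>" for R y m
      using ext x that unfolding rooted_extension_def by blast+
    have "\<forall>R\<in>\<R>. \<exists>c\<le>k. rt R x \<in> K c"
      using rt(1) by (auto simp: S_def)
    then obtain col where col: "\<And>R. R \<in> \<R> \<Longrightarrow> col R \<le> k \<and> rt R x \<in> K (col R)"
      by metis
    have "finite \<R>" "card \<R> \<le> k"
      using \<R> by (auto simp: tree_family_def)
    then have "card (col ` \<R>) < card {..k}"
      using card_image_le[of \<R> col] by simp
    then have "\<not> {..k} \<subseteq> col ` \<R>"
      using \<open>finite \<R>\<close> card_mono[of "col ` \<R>" "{..k}"] by auto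
    then obtain c where c: "c \<le> k" "c \<notin> col ` \<R>"
      by auto
    then obtain y where y: "y \<in> K c"
      using nonempty by blast
    then have "y \<in> S"
      using c by (auto simp: S_def)
    have far: "far R 4 x y" if "R \<in> \<R>" for R
    proof -
      have "far R 3 (rt R x) y"
        using far_familyD(3)[OF K(1) that, of "col R" c] col[OF that] c y that by blast
      then show ?thesis
        using rt(2)[OF that \<open>y \<in> S\<close>, of 3] by simp
    qed
    show "\<exists>x<Suc b'. \<exists>y<Suc b'. (x, y) \<in> adj \<and> (\<forall>R\<in>\<R>. far R 4 x y)"
    proof (intro exI conjI ballI)
      show "x < Suc b'"
        using x W(1) by auto
      show "y < Suc b'"
        using \<open>y \<in> S\<close> K(2) \<open>b \<le> b'\<close> unfolding S_def by (meson le_less_trans lessThan_iff less_Suc_eq_le less_imp_le_nat order_trans subsetD)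
      show "(x, y) \<in> adj"
        using ext x \<open>y \<in> S\<close> unfolding rooted_extension_def by (blast intro: clique_adj)
    qed (rule far)
  qed simp
qed

section \<open>Transfer to graphs and spanning trees\<close>

definition universal_graph :: "nat \<Rightarrow> nat pair_pre_digraph" where
  "universal_graph n = \<lparr>pverts = {..<n}, parcs = adj \<inter> {..<n} \<times> {..<n}\<rparr>"

lemma adj_sym: "(u, v) \<in> adj \<Longrightarrow> (v, u) \<in> adj"
  by (auto simp: adj_def)

lemma pair_graph_universal_graph: "pair_graph (universal_graph n)"
proof
  show "symmetric (with_proj (universal_graph n))"
    by (auto simp: symmetric_def universal_graph_def intro!: symI adj_sym)
qed (auto simp: universal_graph_def adj_def dest: lower_less)

text \<open>Every positive vertex has a smaller neighbour, so descending reaches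
  \<open>0\<close>.\<close>

lemma connected_universal_graph:
  assumes "0 < n"
  shows "connected (with_proj (universal_graph n))"
proof -
  interpret pair_graph "universal_graph n"
    by (rule pair_graph_universal_graph)
  have to_0: "v \<rightarrow>\<^sup>*\<^bsub>universal_graph n\<^esub> 0" if "v < n" for v
    using that
  proof (induction v rule: less_induct)
    case (less v)
    show ?case
    proof (cases "v = 0")
      case True
      then show ?thesis
        using reachable_refl[of 0] assms by (simp add: universal_graph_def)
    next
      case False
      then obtain u where u: "u \<in> lower v" "u < v"
        using ex_in_lower lower_less by blast
      then have "(v, u) \<in> parcs (universal_graph n)"
        using less.prems by (auto simp: universal_graph_def adj_def)
      then show ?thesis
        using less.IH[of u] u less.prems adj_reachable_trans by auto
    qed
  qed
  show ?thesis
    unfolding connected_def strongly_connected_def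
  proof (intro conjI ballI)
    show "verts (with_proj (mk_symmetric (with_proj (universal_graph n)))) \<noteq> {}"
      using assms by (auto simp: universal_graph_def)
  next
    fix u v
    assume "u \<in> verts (with_proj (mk_symmetric (with_proj (universal_graph n))))"
      "v \<in> verts (with_proj (mk_symmetric (with_proj (universal_graph n))))"
    then have "u < n" "v < n"
      by (simp_all add: universal_graph_def)
    then have "u \<rightarrow>\<^sup>*\<^bsub>universal_graph n\<^esub> v"
      using reachable_trans[OF to_0 symmetric_reachable[OF sym_arcs to_0]] by blast
    then show "u \<rightarrow>\<^sup>*\<^bsub>mk_symmetric (universal_graph n)\<^esub> v"
      by (rule reachable_mk_symmetricI)
  qed
qed

section \<open>Chordality of the universal graph\<close>

lemma pcas_map: "pcas u p v \<Longrightarrow> map fst p @ [v] = u # map snd p"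
  by (induction u p v rule: pcas.induct) auto

lemma pawalk_verts_eq: "pcas u p v \<Longrightarrow> pawalk_verts u p = u # map snd p"
  by (induction u p v rule: pcas.induct) auto

text \<open>The two cycle neighbours of the largest vertex on a cycle are smaller neighbours of it,
  hence adjacent. In an induced cycle their edge would belong to the cycle, which forces a
  triangle.\<close>

lemma chordal_universal_graph: "chordal (universal_graph n)"
  unfolding chordal_def
proof (rule notI, elim exE conjE)
  fix p assume ind: "induced_cycle (universal_graph n) p" and len: "3 < length p"
  interpret pair_graph "universal_graph n"
    by (rule pair_graph_universal_graph)
  have arcs: "{e \<in> parcs (universal_graph n). fst e \<in> fst ` set p \<and> snd e \<in> fst ` set p} = set p \<union> (set p)\<inverse>"
    using ind by (simp add: induced_cycle_def)
  obtain u where u: "awalk u p u" "distinct (tl (awalk_verts u p))"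
    using ind by (auto simp: induced_cycle_def undirected_cycle_def cycle_def)
  have "set p \<subseteq> parcs (universal_graph n)"
    using u(1) by (simp add: awalk_def)
  then have arcs_sub: "set p \<subseteq> adj \<inter> {..<n} \<times> {..<n}"
    by (simp add: universal_graph_def)
  define N where "N = length p"
  \<comment> \<open>Reading positions modulo \<open>N\<close> lets every vertex of the cycle have a
    predecessor and a successor without wrap-around cases.\<close>
  define f where "f i = snd (p ! (i mod N))" for i
  have "N > 3"
    using len by (simp add: N_def)
  have cas: "pcas u p u"
    using u(1) by (simp add: awalk_def)
  have dist: "distinct (map snd p)"
    using u(2) by (simp add: pawalk_verts_eq[OF cas])
  have inj: "f i = f j \<longleftrightarrow> i mod N = j mod N" for i j
  proof -
    have "i mod N < length p" "j mod N < length p"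
      using len by (auto simp: N_def intro!: mod_less_divisor)
    then show ?thesis
      using nth_eq_iff_index_eq[OF dist, of "i mod N" "j mod N"] by (simp add: f_def)
  qed
  have neq: "f i \<noteq> f (i + d)" if "0 < d" "d < N" for i d
    using that mod_eq_dvd_iff_nat[of i "i + d" N] by (auto simp: inj dest: nat_dvd_not_less)
  have f_Suc: "f (Suc i) = f (Suc j)" if "f i = f j" for i j
    using that unfolding inj by (metis mod_Suc_eq)
  have p_nth: "p ! (Suc i mod N) = (f i, f (Suc i))" for i
  proof -
    have less: "Suc i mod N < N" "i mod N < N"
      using \<open>N > 3\<close> by auto
    have walk: "(map fst p @ [u]) ! j = (u # map snd p) ! j" for j
      using pcas_map[OF cas] by simp
    have "fst (p ! (Suc i mod N)) = f i"
    proof (cases "Suc (i mod N) = N")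
      case True
      then have "fst (p ! 0) = u"
        using walk[of 0] \<open>N > 3\<close> by (cases p) (auto simp: N_def)
      also have "\<dots> = map snd p ! (i mod N)"
        using walk[of "Suc (i mod N)"] True by (simp add: nth_append N_def)
      also have "\<dots> = f i"
        using less(2) by (simp add: f_def N_def)
      finally show ?thesis
        using True by (simp add: mod_Suc)
    next
      case False
      then show ?thesis
        using walk[of "Suc i mod N"] less by (simp add: f_def mod_Suc nth_append N_def)
    qed
    then show ?thesis
      by (simp add: f_def prod_eq_iff)
  qed
  have arcs_f: "e \<in> set p \<longleftrightarrow> (\<exists>i. e = (f i, f (Suc i)))" for e
  proof
    assume "e \<in> set p"
    then obtain j where "j < N" "e = p ! j"
      by (auto simp: in_set_conv_nth N_def)
    then have "e = p ! (Suc (j + N - 1) mod N)"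
      using \<open>N > 3\<close> by simp
    then show "\<exists>i. e = (f i, f (Suc i))"
      using p_nth by blast
  next
    assume "\<exists>i. e = (f i, f (Suc i))"
    then obtain i where "e = p ! (Suc i mod N)"
      using p_nth by metis
    moreover have "Suc i mod N < length p" for i
      using \<open>N > 3\<close> by (simp add: N_def[symmetric])
    ultimately show "e \<in> set p"
      by (metis nth_mem)
  qed
  have f_verts: "f i \<in> fst ` set p" for i
    using arcs_f by force
  have "finite (range f)"
    using f_verts by (meson List.finite_set finite_imageI finite_subset image_subsetI)
  then have "Max (range f) \<in> range f"
    by (intro Max_in) auto
  then obtain j where "Max (range f) = f j"
    by blast
  \<comment> \<open>Shifting by one period writes the position of the maximum as a
    successor.\<close>
  moreover have "f j = f (Suc (j + N - 1))"
    using \<open>N > 3\<close> by (simp add: inj)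
  ultimately obtain m where "Max (range f) = f (Suc m)"
    by metis
  then have max: "f i \<le> f (Suc m)" for i
    using Max_ge[OF \<open>finite (range f)\<close>, of "f i"] by simp
  have lower: "f j \<in> lower (f (Suc m))" if "(f j, f (Suc m)) \<in> adj" for j
    using that max[of j] lower_less[of "f (Suc m)" "f j"] by (auto simp: adj_def)
  have adj: "(f i, f (Suc i)) \<in> adj" for i
    using arcs_f arcs_sub by blast
  have "f m \<in> lower (f (Suc m))" "f (Suc (Suc m)) \<in> lower (f (Suc m))"
    using lower adj adj_sym by blast+
  moreover have "f m \<noteq> f (Suc (Suc m))"
    using neq[of 2 m] \<open>N > 3\<close> by simp
  ultimately have "(f m, f (Suc (Suc m))) \<in> adj"
    using clique_adj[OF clique_lower] by blast
  moreover have "f i < n" for i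
    using arcs_f[of "(f i, f (Suc i))"] arcs_sub by blast
  ultimately have "(f m, f (Suc (Suc m))) \<in> set p \<union> (set p)\<inverse>"
    unfolding arcs[symmetric] using f_verts by (simp add: universal_graph_def)
  then have "\<exists>i. f i = f m \<and> f (Suc i) = f (Suc (Suc m)) \<or> f i = f (Suc (Suc m)) \<and> f (Suc i) = f m"
    unfolding Un_iff converse_iff arcs_f prod.inject by metis
  then obtain i where "f i = f m \<and> f (Suc i) = f (Suc (Suc m)) \<or> f i = f (Suc (Suc m)) \<and> f (Suc i) = f m"
    by (elim exE)
  then show False
  \<comment> \<open>In one direction positions \<open>m + 1\<close> and \<open>m + 2\<close> would
    coincide, in the other \<open>m\<close> and \<open>m + 3\<close>; the latter is excluded by
    \<open>N > 3\<close>.\<close>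
  proof (elim disjE conjE)
    assume "f i = f m" "f (Suc i) = f (Suc (Suc m))"
    then show False
      using f_Suc[of i m] neq[of 1 "Suc m"] \<open>N > 3\<close> by simp
  next
    assume "f i = f (Suc (Suc m))" "f (Suc i) = f m"
    then show False
      using f_Suc[of i "Suc (Suc m)"] neq[of 3 m] \<open>N > 3\<close> by (simp add: numeral_3_eq_3)
  qed
qed

section \<open>Graph distances and spanning trees in terms of relations\<close>

lemma (in pair_wf_digraph) relpow_of_awalk: "awalk u p v \<Longrightarrow> (u, v) \<in> parcs G ^^ length p"
proof (induction p arbitrary: u)
  case (Cons e es)
  then have "(u, snd e) \<in> parcs G" "(snd e, v) \<in> parcs G ^^ length es"
    by (auto simp: awalk_Cons_iff)
  then show ?case
    by (auto intro: relpow_Suc_I2 simp del: relpow.simps)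
qed (simp add: awalk_Nil_iff)

lemma graph_dist_le_1:
  assumes "pair_graph G" "(u, v) \<in> parcs G"
  shows "graph_dist G u v \<le> 1"
proof -
  interpret pair_graph G by fact
  have "awalk u [(u, v)] v"
    using assms(2) by (auto simp: awalk_simps dest: in_arcsD1 in_arcsD2)
  then show ?thesis
    unfolding graph_dist_def using min_cost_le_walk_cost[of u "[(u, v)]" v "\<lambda>_. 1"] by (simp add: one_ereal_def)
qed

lemma graph_dist_ge_of_far:
  assumes "pair_graph T" "far (parcs T) k u v"
  shows "ereal k \<le> graph_dist T u v"
proof -
  interpret pair_graph T by fact
  have cost: "awalk_cost (\<lambda>_. 1) p = length p" for p :: "('a \<times> 'a) list"
    by (induction p) simp_all
  have "k \<le> length p" if "awalk u p v" for p
    using relpow_of_awalk[OF that] assms(2) by (meson far_def not_le)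
  then show ?thesis
    unfolding graph_dist_def \<mu>_def by (auto intro!: INF_greatest simp: cost)
qed

text \<open>Shorten the walk to a simple path in the graph without the edge and close it with
  \<open>(v, u)\<close>. The path has at least two arcs, because there are no loops and
  \<open>(u, v)\<close> was removed.\<close>

lemma cycle_of_avoiding_walk:
  assumes T: "pair_graph T" and "(u, v) \<in> parcs T"
    and walk: "(u, v) \<in> (parcs T - {(u, v), (v, u)})\<^sup>*"
  shows "\<exists>p. undirected_cycle T p"
proof -
  interpret T: pair_graph T by fact
  define H where "H = \<lparr>pverts = pverts T, parcs = parcs T - {(u, v), (v, u)}\<rparr>"
  interpret H: pair_wf_digraph H
    by unfold_locales (auto simp: H_def dest: T.in_arcsD1 T.in_arcsD2)
  have "u \<in> pverts T"
    using assms(2) by (rule T.in_arcsD1)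
  have "u \<rightarrow>\<^sup>*\<^bsub>H\<^esub> v"
    using walk
  proof (induction rule: rtrancl_induct)
    case base
    then show ?case
      using H.reachable_refl[of u] \<open>u \<in> pverts T\<close> by (simp add: H_def)
  next
    case (step y z)
    then show ?case
      using H.reachable_adj_trans[of u y z] by (simp add: H_def)
  qed
  then obtain p where p: "H.apath u p v"
    by (auto simp: H.reachable_apath)
  then have walk_H: "H.awalk u p v" and dist: "distinct (pawalk_verts u p)"
    by (auto simp: H.apath_def)
  have "T.awalk u p v"
    using walk_H unfolding H.awalk_def T.awalk_def by (auto simp: H_def)
  then have "T.awalk v ((v, u) # p) v"
    using T.arcs_symmetric[OF assms(2)] by (simp add: T.awalk_Cons_iff)
  moreover have "2 \<le> length p"
  proof -
    have "p \<noteq> []"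
      using walk_H T.no_loops'[OF assms(2)] by (auto simp: H.awalk_Nil_iff)
    moreover have "p \<noteq> [e]" for e
    proof
      assume "p = [e]"
      then have "e \<in> parcs H" "e = (u, v)"
        using walk_H by (auto simp: H.awalk_simps prod_eq_iff)
      then show False
        by (simp add: H_def)
    qed
    ultimately show ?thesis
      by (cases p; cases "tl p") auto
  qed
  ultimately have "undirected_cycle T ((v, u) # p)"
    using dist by (auto simp: undirected_cycle_def T.cycle_def)
  then show ?thesis by blast
qed

text \<open>The parent of a vertex is its successor on a shortest path to \<open>0\<close>.\<close>
lemma is_tree_of_undirected_spanning_tree:
  assumes "undirected_spanning_tree T (universal_graph n)" "0 < n"
  shows "is_tree n (parcs T)"
proof -
  define R where "R = parcs T"
  have T: "pair_graph T" "connected T" and acyclic: "\<not> (\<exists>p. undirected_cycle T p)"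
    and sub: "subgraph T (universal_graph n)" and verts: "pverts T = {..<n}"
    using assms by (auto simp: undirected_spanning_tree_def connected_graph_def spanning_def universal_graph_def)
  interpret pair_graph T by (rule T(1))
  have R_sub: "R \<subseteq> adj \<inter> {..<n} \<times> {..<n}"
    using sub by (auto simp: R_def subgraph_def universal_graph_def)
  have "sym R"
    using arcs_symmetric by (auto simp: R_def intro: symI)
  have reach: "\<exists>l. (v, 0) \<in> R ^^ l" if "v < n" for v
  proof -
    have "strongly_connected T"
      using symmetric_connected_imp_strongly_connected[OF sym_arcs] T(2) by simp
    then have "v \<rightarrow>\<^sup>*\<^bsub>T\<^esub> 0"
      using that assms(2) verts by (auto simp: strongly_connected_def)
    then show ?thesis
      using relpow_of_awalk unfolding reachable_awalk R_def by blast
  qed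
  define dep where "dep v = (LEAST l. (v, 0) \<in> R ^^ l)" for v
  have dep: "(v, 0) \<in> R ^^ dep v" if "v < n" for v
    unfolding dep_def using reach[OF that] by (rule LeastI_ex)
  have dep_le: "dep v \<le> l" if "(v, 0) \<in> R ^^ l" for v l
    unfolding dep_def using that by (rule Least_le)
  have "\<exists>u. (v, u) \<in> R \<and> dep v = Suc (dep u)" if v: "0 < v" "v < n" for v
  proof -
    obtain d where d: "dep v = Suc d"
      using dep[of v] v by (cases "dep v") auto
    then obtain u where u: "(v, u) \<in> R" "(u, 0) \<in> R ^^ d"
      using dep[of v] v by (metis relpow_Suc_D2)
    have "u < n"
      using u(1) R_sub by auto
    then have "dep v \<le> Suc (dep u)"
      using dep_le dep u(1) by (meson relpow_Suc_I2)
    then show ?thesis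
      using u d dep_le[OF u(2)] by (intro exI[of _ u]) auto
  qed
  then obtain par where par: "\<And>v. 0 < v \<Longrightarrow> v < n \<Longrightarrow> (v, par v) \<in> R \<and> dep v = Suc (dep (par v))"
    by metis
  have "0 < u \<and> v = par u \<or> 0 < v \<and> u = par v" if "(u, v) \<in> R" for u v
  proof (rule ccontr)
    assume not_par: "\<not> ?thesis"
    \<comment> \<open>Removing a non-parent edge keeps all parent edges, so both of its ends still
      reach \<open>0\<close> and hence each other, which gives a cycle.\<close>
    define R' where "R' = R - {(u, v), (v, u)}"
    have "sym R'"
      using \<open>sym R\<close> by (auto simp: R'_def sym_def)
    have to_0: "(x, 0) \<in> R'\<^sup>*" if "x < n" for x
      using that
    proof (induction "dep x" arbitrary: x rule: less_induct)
      case less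
      show ?case
      proof (cases "x = 0")
        case False
        then have x: "(x, par x) \<in> R" "dep (par x) < dep x"
          using par less.prems by auto
        moreover have "par x < n"
          using x(1) R_sub by auto
        moreover have "(x, par x) \<in> R'"
          using x(1) not_par False by (auto simp: R'_def)
        ultimately show ?thesis
          using less.hyps by (meson converse_rtrancl_into_rtrancl)
      qed simp
    qed
    have "u < n" "v < n"
      using that R_sub by auto
    then have "(u, v) \<in> R'\<^sup>*"
      using to_0 sym_rtrancl[OF \<open>sym R'\<close>] by (meson rtrancl_trans symD)
    then show False
      using cycle_of_avoiding_walk[OF T(1)] that acyclic unfolding R'_def R_def by blast
  qed
  then have "rooted_tree n R par dep"
    unfolding rooted_tree_def using R_sub \<open>sym R\<close> par by blast
  then show ?thesis
    unfolding is_tree_def R_def by blast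
qed

theorem theorem9:
  fixes \<mu> :: nat
  assumes "0 < \<mu>"
  shows "\<exists>G :: nat pair_pre_digraph. connected_graph G \<and> chordal G \<and>
           \<not> (\<exists>\<T>. finite \<T> \<and> card \<T> \<le> \<mu> \<and>
                 (\<forall>T \<in> \<T>. undirected_spanning_tree T G) \<and>
                 collectively_spans \<T> 2 G)"
proof -
  obtain n where "0 < n" and far_edge: "\<And>\<R>. tree_family \<mu> n \<R> \<Longrightarrow>
      \<exists>x<n. \<exists>y<n. (x, y) \<in> adj \<and> (\<forall>R\<in>\<R>. far R 4 x y)"
    by (rule obtain_far_edge[of \<mu>]) blast
  have "\<not> collectively_spans \<T> 2 (universal_graph n)"
    if \<T>: "finite \<T>" "card \<T> \<le> \<mu>" "\<forall>T\<in>\<T>. undirected_spanning_tree T (universal_graph n)" for \<T>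
  proof
    assume span: "collectively_spans \<T> 2 (universal_graph n)"
    have "tree_family \<mu> n (parcs ` \<T>)"
      unfolding tree_family_def
      using \<T> is_tree_of_undirected_spanning_tree[OF _ \<open>0 < n\<close>] card_image_le[OF \<T>(1), of parcs] by auto
    then obtain x y where xy: "x < n" "y < n" "(x, y) \<in> adj" and far: "\<And>T. T \<in> \<T> \<Longrightarrow> far (parcs T) 4 x y"
      using far_edge[of "parcs ` \<T>"] by blast
    obtain T where "T \<in> \<T>" and T: "graph_dist T x y \<le> graph_dist (universal_graph n) x y + ereal 2"
      using span xy by (auto simp: collectively_spans_def universal_graph_def)
    \<comment> \<open>As \<open>x\<close> and \<open>y\<close> are adjacent, the tree distance would
      be at most 3, while \<open>far\<close> makes it at least 4.\<close>
    have "graph_dist (universal_graph n) x y \<le> 1"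
      using xy by (intro graph_dist_le_1 pair_graph_universal_graph) (auto simp: universal_graph_def)
    then have "graph_dist T x y \<le> 1 + ereal 2"
      using T add_right_mono order_trans by blast
    moreover have "ereal 4 \<le> graph_dist T x y"
      using graph_dist_ge_of_far[OF _ far[OF \<open>T \<in> \<T>\<close>]] \<T>(3) \<open>T \<in> \<T>\<close>
      by (auto simp: undirected_spanning_tree_def connected_graph_def)
    ultimately have "ereal 4 \<le> 1 + ereal 2"
      by (rule order_trans[rotated])
    then show False
      by (simp add: one_ereal_def)
  qed
  moreover have "connected_graph (universal_graph n)"
    using pair_graph_universal_graph connected_universal_graph[OF \<open>0 < n\<close>] by (simp add: connected_graph_def)
  ultimately show ?thesis
    using chordal_universal_graph by blast
qed

end
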